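(* Let $\theta\in[1/2,1]$. A vector $(y_n^0,\dots,y_n^{N_n})\in Y^{N_n+1}$ solves the $\theta$-scheme $$\partial\psi\big(y_n^i-y_n^{i-1}\big)+A\big(\theta y_n^i+(1-\theta)y_n^{i-1}\big)\ni\ell(t_{n,\theta}^i)\quad\text{for } i=1,\dots,N_n,\qquad y_n^0=y_0,$$ if and only if $F_n^\theta(y_n^0,\dots,y_n^{N_n})=0=\min F_n^\theta$.
   Context: Let $T>0$ and let $Y$ be a separable reflexive real Banach space with norm $|\cdot|$, dual $Y^*$, and duality pairing $\langle\cdot,\cdot\rangle$ between $Y^*$ and $Y$. Let $\psi:Y\to[0,\infty]$ be proper, convex, lower semicontinuous and positively $1$-homogeneous; $C=D(\psi)=\{y:\psi(y)<\infty\}$; $\partial\psi$ is the subdifferential of convex analysis, and $\psi^*(w)=\sup_{v\in Y}(\langle w,v\rangle-\psi(v))$ is the conjugate, i.e. the indicator function of the closed convex set $C^*=\partial\psi(0)\subset Y^*$. Let $A:Y\to Y^*$ be linear, continuous and symmetric, $\phi(y)=\frac12\langle Ay,y\rangle$, and assume there is $\alpha>0$ with $\phi(y)\ge\frac{\alpha}{2}|y|^2$ for all $y\in C$. Let $\chi(y)=\phi(y)+|y|^2$, and assume $\chi\ge 0$ on $Y$ with $\chi(y)=0$ iff $y=0$. Let $\ell\in W^{1,\infty}(0,T;Y^* )$ and let $y_0\in C$ be stable at time $0$, i.e. $\ell(0)-Ay_0\in C^*$. Let $0=t_n^0<t_n^1<\dots<t_n^{N_n}=T$ be a partition, $\tau_n^i=t_n^i-t_n^{i-1}$,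 $t_{n,\theta}^i=\theta t_n^i+(1-\theta)t_n^{i-1}$. Define $L_n^{\theta,i}:Y\times Y\to[0,\infty]$ and $F_n^\theta:Y^{N_n+1}\to[0,\infty]$ by $$L_n^{\theta,i}(y,z)=\psi\Big(\frac{y-z}{\tau_n^i}\Big)+\psi^*\big(\ell(t_{n,\theta}^i)-A(\theta y+(1-\theta)z)\big)-\Big\langle\ell(t_{n,\theta}^i)-A(\theta y+(1-\theta)z),\frac{y-z}{\tau_n^i}\Big\rangle,$$ $$F_n^\theta(y^0,\dots,y^{N_n})=\sum_{i=1}^{N_n}\tau_n^iL_n^{\theta,i}(y^i,y^{i-1})+\chi(y^0-y_0).$$ *)

theory Defs
  imports "HOL-Analysis.Analysis"
begin

text \<open>The dual of a real normed space \<open>'a\<close> is \<open>'a \<Rightarrow>\<^sub>L real\<close>; the pairing of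
  \<open>w\<close> and \<open>y\<close> is \<open>blinfun_apply w y\<close>. Functionals with values in \<open>[0,\<infinity>]\<close> are rendered as
  \<open>ereal\<close>-valued functions together with a nonnegativity hypothesis (conjugates need
  subtraction, so \<open>ennreal\<close> would not do).\<close>

definition reflexive_space :: "'a::real_normed_vector itself \<Rightarrow> bool" where
  "reflexive_space _ \<longleftrightarrow>
     (\<forall>\<Phi> :: ('a \<Rightarrow>\<^sub>L real) \<Rightarrow>\<^sub>L real. \<exists>y::'a. \<forall>w. blinfun_apply \<Phi> w = blinfun_apply w y)"


subsection \<open>Convex analysis\<close>

definition effective_domain :: "('a \<Rightarrow> ereal) \<Rightarrow> 'a set" where
  "effective_domain f = {y. f y < \<infinity>}"

definition proper_fun :: "('a \<Rightarrow> ereal) \<Rightarrow> bool" where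
  "proper_fun f \<longleftrightarrow> effective_domain f \<noteq> {} \<and> (\<forall>y. f y \<noteq> -\<infinity>)"

definition convex_fun :: "('a::real_vector \<Rightarrow> ereal) \<Rightarrow> bool" where
  "convex_fun f \<longleftrightarrow>
     (\<forall>x y s. 0 \<le> s \<and> s \<le> 1 \<longrightarrow>
        f ((1 - s) *\<^sub>R x + s *\<^sub>R y) \<le> ereal (1 - s) * f x + ereal s * f y)"

definition lower_semicontinuous :: "('a::topological_space \<Rightarrow> ereal) \<Rightarrow> bool" where
  "lower_semicontinuous f \<longleftrightarrow> (\<forall>x. f x \<le> Liminf (at x) f)"

definition positively_homogeneous :: "('a::real_vector \<Rightarrow> ereal) \<Rightarrow> bool" where
  "positively_homogeneous f \<longleftrightarrow> (\<forall>c>0. \<forall>y. f (c *\<^sub>R y) = ereal c * f y)"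

text \<open>For a proper \<open>f\<close> the following set is empty outside the effective domain.\<close>

definition subdifferential :: "('a::real_normed_vector \<Rightarrow> ereal) \<Rightarrow> 'a \<Rightarrow> ('a \<Rightarrow>\<^sub>L real) set" where
  "subdifferential f y = {w. \<forall>v. f y + ereal (blinfun_apply w (v - y)) \<le> f v}"

definition conjugate :: "('a::real_normed_vector \<Rightarrow> ereal) \<Rightarrow> ('a \<Rightarrow>\<^sub>L real) \<Rightarrow> ereal" where
  "conjugate f w = (SUP v. ereal (blinfun_apply w v) - f v)"


subsection \<open>The space \<open>W\<^sup>1\<^sup>,\<^sup>\<infinity>(0,T;X)\<close>\<close>

definition strongly_measurable :: "'t measure \<Rightarrow> ('t \<Rightarrow> 'b::real_normed_vector) \<Rightarrow> bool" where
  "strongly_measurable M g \<longleftrightarrow>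
     (\<exists>s. (\<forall>k::nat. simple_function M (s k)) \<and> (AE t in M. (\<lambda>k. s k t) \<longlonglongrightarrow> g t))"

definition L_infinity :: "'t measure \<Rightarrow> ('t \<Rightarrow> 'b::real_normed_vector) \<Rightarrow> bool" where
  "L_infinity M g \<longleftrightarrow> strongly_measurable M g \<and> (\<exists>K. AE t in M. norm (g t) \<le> K)"

definition test_function :: "real \<Rightarrow> (real \<Rightarrow> real) \<Rightarrow> bool" where
  "test_function T \<phi> \<longleftrightarrow>
     (\<forall>k t. (deriv ^^ k) \<phi> differentiable (at t)) \<and>
     compact (closure {t. \<phi> t \<noteq> 0}) \<and> closure {t. \<phi> t \<noteq> 0} \<subseteq> {0<..<T}"

text \<open>Elements are identified with their continuous representative on \<open>[0,T]\<close>, so that point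
  values make sense. The weak derivative is expressed with the gauge integral because the Bochner
  integral of the library is restricted to second countable value types, a class of which
  \<open>'a \<Rightarrow>\<^sub>L real\<close> is not an instance. All integrands below are strongly measurable and essentially
  bounded, and for these the gauge integral coincides with the Bochner integral.\<close>

definition W_1_infinity :: "real \<Rightarrow> (real \<Rightarrow> 'b::real_normed_vector) \<Rightarrow> bool" where
  "W_1_infinity T u \<longleftrightarrow>
     continuous_on {0..T} u \<and> L_infinity (lebesgue_on {0<..<T}) u \<and>
     (\<exists>g. L_infinity (lebesgue_on {0<..<T}) g \<and>
        (\<forall>\<phi>. test_function T \<phi> \<longrightarrow>
           (\<exists>I. ((\<lambda>t. deriv \<phi> t *\<^sub>R u t) has_integral I) {0<..<T} \<and>
                ((\<lambda>t. \<phi> t *\<^sub>R g t) has_integral (- I)) {0<..<T})))"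


subsection \<open>Energies, the \<open>\<theta>\<close>-scheme and the discrete functional\<close>

definition quad_energy :: "('a::real_normed_vector \<Rightarrow>\<^sub>L 'a \<Rightarrow>\<^sub>L real) \<Rightarrow> 'a \<Rightarrow> real" where
  "quad_energy A y = 1/2 * blinfun_apply (blinfun_apply A y) y"

definition chi :: "('a::real_normed_vector \<Rightarrow>\<^sub>L 'a \<Rightarrow>\<^sub>L real) \<Rightarrow> 'a \<Rightarrow> real" where
  "chi A y = quad_energy A y + (norm y)\<^sup>2"

definition is_partition :: "real \<Rightarrow> nat \<Rightarrow> (nat \<Rightarrow> real) \<Rightarrow> bool" where
  "is_partition T N t \<longleftrightarrow> t 0 = 0 \<and> t N = T \<and> (\<forall>i\<in>{1..N}. t (i - 1) < t i)"

definition time_step :: "(nat \<Rightarrow> real) \<Rightarrow> nat \<Rightarrow> real" where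
  "time_step t i = t i - t (i - 1)"

definition theta_node :: "real \<Rightarrow> (nat \<Rightarrow> real) \<Rightarrow> nat \<Rightarrow> real" where
  "theta_node \<theta> t i = \<theta> * t i + (1 - \<theta>) * t (i - 1)"

text \<open>A vector in \<open>Y\<^sup>N\<^sup>+\<^sup>1\<close> is a function \<open>nat \<Rightarrow> 'a\<close>, of which only the entries with indices
  \<open>0, \<dots>, N\<close> are ever read; likewise for the nodes of a partition.\<close>

definition solves_theta_scheme ::
  "('a::real_normed_vector \<Rightarrow> ereal) \<Rightarrow> ('a \<Rightarrow>\<^sub>L 'a \<Rightarrow>\<^sub>L real) \<Rightarrow> (real \<Rightarrow> 'a \<Rightarrow>\<^sub>L real) \<Rightarrow> 'a \<Rightarrow>
   nat \<Rightarrow> (nat \<Rightarrow> real) \<Rightarrow> real \<Rightarrow> (nat \<Rightarrow> 'a) \<Rightarrow> bool" where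
  "solves_theta_scheme \<psi> A l y0 N t \<theta> y \<longleftrightarrow>
     (\<forall>i\<in>{1..N}.
        l (theta_node \<theta> t i) \<in>
          (\<lambda>\<xi>. \<xi> + blinfun_apply A (\<theta> *\<^sub>R y i + (1 - \<theta>) *\<^sub>R y (i - 1)))
            ` subdifferential \<psi> (y i - y (i - 1))) \<and>
     y 0 = y0"

definition L_theta ::
  "('a::real_normed_vector \<Rightarrow> ereal) \<Rightarrow> ('a \<Rightarrow>\<^sub>L 'a \<Rightarrow>\<^sub>L real) \<Rightarrow> (real \<Rightarrow> 'a \<Rightarrow>\<^sub>L real) \<Rightarrow>
   (nat \<Rightarrow> real) \<Rightarrow> real \<Rightarrow> nat \<Rightarrow> 'a \<Rightarrow> 'a \<Rightarrow> ereal" where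
  "L_theta \<psi> A l t \<theta> i y z =
     (let w = l (theta_node \<theta> t i) - blinfun_apply A (\<theta> *\<^sub>R y + (1 - \<theta>) *\<^sub>R z);
          v = (y - z) /\<^sub>R time_step t i
      in \<psi> v + conjugate \<psi> w - ereal (blinfun_apply w v))"

definition F_theta ::
  "('a::real_normed_vector \<Rightarrow> ereal) \<Rightarrow> ('a \<Rightarrow>\<^sub>L 'a \<Rightarrow>\<^sub>L real) \<Rightarrow> (real \<Rightarrow> 'a \<Rightarrow>\<^sub>L real) \<Rightarrow> 'a \<Rightarrow>
   nat \<Rightarrow> (nat \<Rightarrow> real) \<Rightarrow> real \<Rightarrow> (nat \<Rightarrow> 'a) \<Rightarrow> ereal" where
  "F_theta \<psi> A l y0 N t \<theta> y =
     (\<Sum>i = 1..N. ereal (time_step t i) * L_theta \<psi> A l t \<theta> i (y i) (y (i - 1)))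
     + ereal (chi A (y 0 - y0))"

text \<open>\<open>m = min f\<close>: the value \<open>m\<close> is attained and is a lower bound.\<close>

definition is_min_value :: "('x \<Rightarrow> ereal) \<Rightarrow> ereal \<Rightarrow> bool" where
  "is_min_value f m \<longleftrightarrow> m \<in> range f \<and> (\<forall>x. m \<le> f x)"

end

theory Submission
  imports Defs
begin

text \<open>By the Fenchel-Young inequality each summand of \<open>F_theta\<close> is nonnegative, and it vanishes
  exactly when the dual variable is a subgradient of \<open>\<psi>\<close> at the discrete velocity. Since \<open>\<psi>\<close> is
  positively homogeneous, its subdifferential is invariant under positive scaling of the base
  point, so the velocity may be replaced by the increment.\<close>

text \<open>The point \<open>v\<close> itself competes in the supremum defining the conjugate. If
  \<open>f v = \<infinity>\<close>, the gap is \<infinity> whatever the conjugate is, because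
  \<open>\<infinity> + (-\<infinity>) = \<infinity>\<close> in \<open>ereal\<close>.\<close>

lemma fenchel_young_gap_nonneg:
  assumes "proper_fun f"
  shows "0 \<le> f v + conjugate f w - ereal (blinfun_apply w v)"
proof -
  have le: "ereal (blinfun_apply w v) - f v \<le> conjugate f w"
    unfolding conjugate_def by (rule SUP_upper) simp
  have "f v \<noteq> -\<infinity>"
    using assms by (simp add: proper_fun_def)
  with le show ?thesis
    by (cases "f v"; cases "conjugate f w") (auto simp: zero_ereal_def)
qed

text \<open>Where \<open>f v\<close> is finite, a zero gap means that the supremum in the conjugate
  is attained at \<open>v\<close>; rearranged for each competitor \<open>u\<close>, this is the
  subgradient inequality.\<close>

lemma fenchel_young_gap_eq_0_iff:
  assumes "proper_fun f"
  shows "f v + conjugate f w - ereal (blinfun_apply w v) = 0 \<longleftrightarrow> w \<in> subdifferential f v"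
proof -
  have ninf: "f u \<noteq> -\<infinity>" for u
    using assms by (simp add: proper_fun_def)
  obtain u0 where u0: "f u0 < \<infinity>"
    using assms by (auto simp: proper_fun_def effective_domain_def)
  show ?thesis
  proof (cases "f v")
    case (real r)
    have upper: "ereal (blinfun_apply w v) - f v \<le> conjugate f w"
      unfolding conjugate_def by (rule SUP_upper) simp
    have "f v + conjugate f w - ereal (blinfun_apply w v) = 0
        \<longleftrightarrow> conjugate f w \<le> ereal (blinfun_apply w v - r)"
      \<comment> \<open>One inequality is always true by \<open>upper\<close>, which also excludes
        the value \<open>-\<infinity>\<close> of the conjugate, so only the reverse inequality
        remains as a condition.\<close>
      using upper real by (cases "conjugate f w") (auto simp: zero_ereal_def)
    also have "\<dots> \<longleftrightarrow> (\<forall>u. ereal (blinfun_apply w u) - f u \<le> ereal (blinfun_apply w v - r))"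
      by (simp add: conjugate_def SUP_le_iff)
    also have "\<dots> \<longleftrightarrow> (\<forall>u. f v + ereal (blinfun_apply w (u - v)) \<le> f u)"
    proof (intro all_cong1)
      fix u
      show "ereal (blinfun_apply w u) - f u \<le> ereal (blinfun_apply w v - r)
          \<longleftrightarrow> f v + ereal (blinfun_apply w (u - v)) \<le> f u"
        using ninf[of u] real by (cases "f u") (auto simp: blinfun.diff_right algebra_simps)
    qed
    finally show ?thesis
      by (simp add: subdifferential_def)
  next
    \<comment> \<open>Both sides are false: the gap is \<infinity>, and a subgradient at
      \<open>v\<close> would force \<open>f u0 = \<infinity>\<close>.\<close>
    case PInf
    have "w \<notin> subdifferential f v"
      using u0 by (auto simp: subdifferential_def PInf)
    then show ?thesis
      using PInf by simp
  next
    case MInf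
    with ninf show ?thesis by simp
  qed
qed

text \<open>The subgradient inequality at \<open>v\<close> is tested with
  \<open>u /\<^sub>R c\<close> and multiplied by \<open>c\<close>; homogeneity then absorbs the
  factor on both sides.\<close>

lemma subdifferential_scale_subset:
  assumes hom: "positively_homogeneous f" and c: "c > 0"
  shows "subdifferential f v \<subseteq> subdifferential f (c *\<^sub>R v)"
proof
  fix w
  assume w: "w \<in> subdifferential f v"
  have "f (c *\<^sub>R v) + ereal (blinfun_apply w (u - c *\<^sub>R v)) \<le> f u" for u
  proof -
    have "ereal c * (f v + ereal (blinfun_apply w (u /\<^sub>R c - v))) \<le> ereal c * f (u /\<^sub>R c)"
      using w c by (intro ereal_mult_left_mono) (auto simp: subdifferential_def)
    also have "ereal c * f (u /\<^sub>R c) = f u"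
      using hom[unfolded positively_homogeneous_def, rule_format, OF c, of "u /\<^sub>R c"] c by simp
    also have "ereal c * (f v + ereal (blinfun_apply w (u /\<^sub>R c - v)))
        = f (c *\<^sub>R v) + ereal (blinfun_apply w (u - c *\<^sub>R v))"
      using hom c
      by (cases "f v") (auto simp: positively_homogeneous_def blinfun.diff_right
          blinfun.scaleR_right algebra_simps)
    finally show ?thesis .
  qed
  then show "w \<in> subdifferential f (c *\<^sub>R v)"
    by (simp add: subdifferential_def)
qed

text \<open>The reverse inclusion is the same one with factor \<open>inverse c\<close> and base
  point \<open>c *\<^sub>R v\<close>.\<close>

lemma subdifferential_scale:
  assumes "positively_homogeneous f" and "c > 0"
  shows "subdifferential f (c *\<^sub>R v) = subdifferential f v"
  using subdifferential_scale_subset[of f c v] subdifferential_scale_subset[of f "inverse c" "c *\<^sub>R v"]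
    assms by auto

lemma L_theta_nonneg:
  assumes "proper_fun \<psi>"
  shows "0 \<le> L_theta \<psi> A l t \<theta> i y z"
  unfolding L_theta_def Let_def using assms by (rule fenchel_young_gap_nonneg)

lemma L_theta_eq_0_iff:
  assumes "proper_fun \<psi>" "positively_homogeneous \<psi>" "time_step t i > 0"
  shows "L_theta \<psi> A l t \<theta> i y z = 0 \<longleftrightarrow>
    l (theta_node \<theta> t i) - blinfun_apply A (\<theta> *\<^sub>R y + (1 - \<theta>) *\<^sub>R z) \<in> subdifferential \<psi> (y - z)"
  unfolding L_theta_def Let_def
  using assms by (simp add: fenchel_young_gap_eq_0_iff subdifferential_scale)

lemma F_theta_nonneg:
  assumes "proper_fun \<psi>" "\<And>v. chi A v \<ge> 0" "\<And>i. i \<in> {1..N} \<Longrightarrow> time_step t i > 0"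
  shows "0 \<le> F_theta \<psi> A l y0 N t \<theta> y"
  unfolding F_theta_def using assms
  by (intro add_nonneg_nonneg sum_nonneg ereal_0_le_mult L_theta_nonneg) (auto simp: less_imp_le)

text \<open>A sum of nonnegative terms vanishes only if every term does; the \<open>chi\<close> term
  is what enforces the initial condition.\<close>

lemma F_theta_eq_0_iff:
  assumes "proper_fun \<psi>" "\<And>v. chi A v \<ge> 0" "\<And>v. chi A v = 0 \<longleftrightarrow> v = 0"
    and pos: "\<And>i. i \<in> {1..N} \<Longrightarrow> time_step t i > 0"
  shows "F_theta \<psi> A l y0 N t \<theta> y = 0 \<longleftrightarrow>
    (\<forall>i\<in>{1..N}. L_theta \<psi> A l t \<theta> i (y i) (y (i - 1)) = 0) \<and> y 0 = y0"
proof -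
  let ?s = "\<lambda>i. ereal (time_step t i) * L_theta \<psi> A l t \<theta> i (y i) (y (i - 1))"
  have nonneg: "0 \<le> ?s i" if "i \<in> {1..N}" for i
    using pos[OF that] assms(1) by (intro ereal_0_le_mult L_theta_nonneg) auto
  have "F_theta \<psi> A l y0 N t \<theta> y = 0 \<longleftrightarrow> (\<Sum>i = 1..N. ?s i) = 0 \<and> ereal (chi A (y 0 - y0)) = 0"
    unfolding F_theta_def using assms(2) nonneg
    by (intro add_nonneg_eq_0_iff sum_nonneg) auto
  also have "(\<Sum>i = 1..N. ?s i) = 0 \<longleftrightarrow> (\<forall>i\<in>{1..N}. ?s i = 0)"
    using nonneg by (intro sum_nonneg_eq_0_iff) auto
  also have "\<dots> \<longleftrightarrow> (\<forall>i\<in>{1..N}. L_theta \<psi> A l t \<theta> i (y i) (y (i - 1)) = 0)"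
    \<comment> \<open>A product in \<open>ereal\<close> is zero only if a factor is, and the time
      step is not.\<close>
    using pos by (intro ball_cong) (force simp: ereal_zero_mult)+
  finally show ?thesis
    using assms(3) by simp
qed

theorem lemma6p3:
  fixes T \<alpha> \<theta> :: real
    and \<psi> :: "'a::banach \<Rightarrow> ereal"
    and A :: "'a \<Rightarrow>\<^sub>L 'a \<Rightarrow>\<^sub>L real"
    and l :: "real \<Rightarrow> 'a \<Rightarrow>\<^sub>L real"
    and y0 :: 'a
    and N :: nat
    and t :: "nat \<Rightarrow> real"
    and y :: "nat \<Rightarrow> 'a"
  assumes "T > 0"
    and "separable_space (euclidean :: 'a topology)"
    and "reflexive_space TYPE('a)"
    and "\<And>v. 0 \<le> \<psi> v"
    and "proper_fun \<psi>" and "convex_fun \<psi>"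
    and "lower_semicontinuous \<psi>" and "positively_homogeneous \<psi>"
    and "\<And>u v. blinfun_apply (blinfun_apply A u) v = blinfun_apply (blinfun_apply A v) u"
    and "\<alpha> > 0"
    and "\<And>v. v \<in> effective_domain \<psi> \<Longrightarrow> quad_energy A v \<ge> \<alpha> / 2 * (norm v)\<^sup>2"
    and "\<And>v. chi A v \<ge> 0"
    and "\<And>v. chi A v = 0 \<longleftrightarrow> v = 0"
    and "W_1_infinity T l"
    and "y0 \<in> effective_domain \<psi>"
    and "l 0 - blinfun_apply A y0 \<in> subdifferential \<psi> 0"
    and "is_partition T N t"
    and "1/2 \<le> \<theta>" and "\<theta> \<le> 1"
  shows "solves_theta_scheme \<psi> A l y0 N t \<theta> y \<longleftrightarrow>
         F_theta \<psi> A l y0 N t \<theta> y = 0 \<and> is_min_value (F_theta \<psi> A l y0 N t \<theta>) 0"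
proof -
  have pos: "time_step t i > 0" if "i \<in> {1..N}" for i
    using assms(17) that by (simp add: is_partition_def time_step_def)
  \<comment> \<open>The scheme asks for membership in a translated subdifferential, whereas
    \<open>L_theta_eq_0_iff\<close> subtracts the translation. The proof of this fact still uses the
    library's \<open>image_iff\<close>; afterwards the name means the local fact.\<close>
  have image_iff: "w \<in> (\<lambda>\<xi>. \<xi> + b) ` S \<longleftrightarrow> w - b \<in> S" for w b :: "'a \<Rightarrow>\<^sub>L real" and S
    by (auto simp: image_iff algebra_simps intro: bexI[of _ "w - b"])
  have "solves_theta_scheme \<psi> A l y0 N t \<theta> y \<longleftrightarrow> F_theta \<psi> A l y0 N t \<theta> y = 0"
  proof -
    have "F_theta \<psi> A l y0 N t \<theta> y = 0 \<longleftrightarrow>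
        (\<forall>i\<in>{1..N}. L_theta \<psi> A l t \<theta> i (y i) (y (i - 1)) = 0) \<and> y 0 = y0"
      by (intro F_theta_eq_0_iff assms(5,12,13) pos)
    then show ?thesis
      unfolding solves_theta_scheme_def image_iff
      using L_theta_eq_0_iff[OF assms(5,8) pos] by simp
  qed
  \<comment> \<open>With 0 as a lower bound, any zero of the functional attains its minimum, so the
    second conjunct follows from the first.\<close>
  moreover have "0 \<le> F_theta \<psi> A l y0 N t \<theta> x" for x
    by (intro F_theta_nonneg assms(5,12) pos)
  ultimately show ?thesis
    by (metis is_min_value_def rangeI)
qed

end
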